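(* For $1<p<\infty$ and $n\ge3$, the $p$-cone $$\mathcal{L}^n_p:=\{(x,t)\in\mathbb{R}^{n-1}\times\mathbb{R}:\|x\|_p\le t\}$$ satisfies $0\in\operatorname{aff}(E_{\mathcal{L}^n_p})$ if and only if $p\ne2$.
   Context: $\|x\|_p=(\sum_i|x_i|^p)^{1/p}$ is the $\ell_p$ norm. For a closed convex cone $K\subset\mathbb{R}^n$, the extremal section is $E_K:=\{u\in\mathbb{R}^n:\|u\|=1,\ \mathbb{R}_+u\text{ is an extreme ray of }K\}$, where $\|\cdot\|$ is the Euclidean norm on $\mathbb{R}^n$. $\operatorname{aff}$ denotes affine hull. *)

theory Defs
  imports "HOL-Analysis.Analysis"
begin

definition lp_norm :: "real \<Rightarrow> real ^ 'm \<Rightarrow> real" where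
  "lp_norm p x = (\<Sum>i\<in>UNIV. \<bar>x $ i\<bar> powr p) powr (1 / p)"

definition ray :: "'a::real_vector \<Rightarrow> 'a set" where
  "ray u = {c *\<^sub>R u |c. 0 \<le> c}"

(* An extreme ray of K is a half-line issuing from the origin that is a face of K. *)
definition extreme_ray_of :: "'a::real_vector set \<Rightarrow> 'a set \<Rightarrow> bool"
    (infixr \<open>(extreme'_ray'_of)\<close> 50) where
  "R extreme_ray_of K \<longleftrightarrow> (\<exists>u. u \<noteq> 0 \<and> R = ray u) \<and> R face_of K"

definition extremal_section :: "'a::euclidean_space set \<Rightarrow> 'a set" where
  "extremal_section K = {u. norm u = 1 \<and> ray u extreme_ray_of K}"

(* R^n is represented as the product (real ^ 'm) \<times> real with CARD('m) = n - 1; the norm of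
   the product type is the Euclidean one, norm (x, t) = sqrt ((norm x)^2 + (norm t)^2). *)
definition p_cone :: "real \<Rightarrow> ((real ^ 'm) \<times> real) set" where
  "p_cone p = {(x, t). lp_norm p x \<le> t}"

end

theory Submission
  imports Defs
begin

text \<open>
  The tangent line inequality for the strictly convex function \<open>s \<mapsto> \<bar>s\<bar>\<^sup>p\<close>, summed over the
  coordinates, shows that the ray through \<open>(w, \<parallel>w\<parallel>\<^sub>p)\<close> is exposed by a linear functional; perturbing
  \<open>x\<close> at constant height shows for \<open>p = 2\<close> that no ray with \<open>\<parallel>x\<parallel> < t\<close> is extreme. So for \<open>p = 2\<close>
  the extremal section lies in the hyperplane \<open>t = 1 / \<surd>2\<close>. For every \<open>p\<close> the midpoint of the
  normalized points through \<open>(w, \<parallel>w\<parallel>\<^sub>p)\<close> and \<open>(- w, \<parallel>w\<parallel>\<^sub>p)\<close> lies on the \<open>t\<close>-axis; the choices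
  \<open>w = e\<^sub>i\<close> and \<open>w = e\<^sub>i + e\<^sub>j\<close> give the same midpoint only if \<open>2\<^bsup>1/p\<^esup> = \<surd>2\<close>, and otherwise their
  affine hull is the whole \<open>t\<close>-axis, which contains \<open>0\<close>.
\<close>

text \<open>For positive \<open>z\<close> the mean value theorem applies, since the derivative
  \<open>p * x powr (p - 1)\<close> is strictly increasing; for \<open>z \<le> 0\<close> the tangent
  line is already negative. Tangency at 1 suffices: other nonzero points follow by scaling.\<close>

lemma powr_gt_tangent:
  fixes p z :: real
  assumes "1 < p" "z \<noteq> 1"
  shows "1 + p * (z - 1) < \<bar>z\<bar> powr p"
proof -
  have der: "((\<lambda>x. x powr p) has_real_derivative p * x powr (p - 1)) (at x)" if "0 < x" for x
    using that by (auto intro!: derivative_eq_intros)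
  consider "z < 0" | "z = 0" | "0 < z" "z < 1" | "1 < z" using assms(2) by linarith
  then show ?thesis
  proof cases
    case 1
    then have "p * (1 - z) > 1 * 1" using assms(1) by (intro mult_strict_mono) auto
    then have "1 + p * (z - 1) < 0" by (simp add: algebra_simps)
    also have "\<dots> \<le> \<bar>z\<bar> powr p" by simp
    finally show ?thesis .
  next
    case 2
    then show ?thesis using assms(1) by simp
  next
    case 3
    obtain \<xi> where \<xi>: "z < \<xi>" "\<xi> < 1" "1 powr p - z powr p = (1 - z) * (p * \<xi> powr (p - 1))"
      using MVT2[OF \<open>z < 1\<close>, of "\<lambda>x. x powr p" "\<lambda>x. p * x powr (p - 1)"] der 3 by fastforce
    have "\<xi> powr (p - 1) < 1"
      using \<xi> 3 assms(1) powr_less_mono2[of "p - 1" \<xi> 1] by simp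
    then have "(1 - z) * (p * \<xi> powr (p - 1)) < (1 - z) * (p * 1)"
      using 3 assms(1) by (intro mult_strict_left_mono) auto
    then show ?thesis using \<xi>(3) 3 by (simp add: algebra_simps)
  next
    case 4
    obtain \<xi> where \<xi>: "1 < \<xi>" "\<xi> < z" "z powr p - 1 powr p = (z - 1) * (p * \<xi> powr (p - 1))"
      using MVT2[OF \<open>1 < z\<close>, of "\<lambda>x. x powr p" "\<lambda>x. p * x powr (p - 1)"] der 4 by fastforce
    have "1 < \<xi> powr (p - 1)"
      using \<xi> assms(1) powr_less_mono2[of "p - 1" 1 \<xi>] by simp
    then have "(z - 1) * (p * 1) < (z - 1) * (p * \<xi> powr (p - 1))"
      using 4 assms(1) by (intro mult_strict_left_mono) auto
    then show ?thesis using \<xi>(3) 4 by (simp add: algebra_simps)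
  qed
qed

text \<open>The gradient at \<open>w\<close> of the sum of \<open>\<bar>w $ i\<bar> powr p\<close>,
  divided by \<open>p\<close>. It defines the functional that exposes the boundary point
  \<open>w\<close> of a p-ball.\<close>

definition dual_vec :: "real \<Rightarrow> real ^ 'm \<Rightarrow> real ^ 'm" where
  "dual_vec p w = (\<chi> i. sgn (w $ i) * \<bar>w $ i\<bar> powr (p - 1))"

lemma dual_vec_mult_self: "dual_vec p w $ i * w $ i = \<bar>w $ i\<bar> powr p"
proof (cases "w $ i = 0")
  case False
  then have "\<bar>w $ i\<bar> powr p = \<bar>w $ i\<bar> powr (p - 1) * \<bar>w $ i\<bar>"
    using powr_add[of "\<bar>w $ i\<bar>" "p - 1" 1] by simp
  then show ?thesis by (simp add: dual_vec_def abs_sgn algebra_simps)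
qed (simp add: dual_vec_def)

lemma abs_powr_gt_tangent:
  assumes "1 < p" "y \<noteq> w $ i"
  shows "\<bar>w $ i\<bar> powr p + p * (dual_vec p w $ i * (y - w $ i)) < \<bar>y\<bar> powr p"
proof (cases "w $ i = 0")
  case True
  then show ?thesis using assms by (simp add: dual_vec_def)
next
  case False
  \<comment> \<open>Tangency at \<open>w $ i\<close> is tangency at 1 in the variable
    \<open>z\<close>, multiplied by \<open>\<bar>w $ i\<bar> powr p\<close>. A zero coordinate has
    slope 0 and was treated apart.\<close>
  define z where "z = y / w $ i"
  have y: "y = z * w $ i" and z: "z \<noteq> 1" using False assms(2) by (auto simp: z_def)
  have "dual_vec p w $ i * (y - w $ i) = (z - 1) * \<bar>w $ i\<bar> powr p"
    by (simp add: dual_vec_mult_self[symmetric]) (simp add: y algebra_simps)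
  moreover have "(1 + p * (z - 1)) * \<bar>w $ i\<bar> powr p < \<bar>z\<bar> powr p * \<bar>w $ i\<bar> powr p"
    using powr_gt_tangent[OF assms(1) z] False by (intro mult_strict_right_mono) auto
  ultimately show ?thesis
    by (simp only: y abs_mult powr_mult) (simp add: algebra_simps)
qed

lemma lp_norm_nonneg: "0 \<le> lp_norm p x"
  by (simp add: lp_norm_def)

lemma lp_norm_powr:
  assumes "p \<noteq> 0"
  shows "lp_norm p x powr p = (\<Sum>i\<in>UNIV. \<bar>x $ i\<bar> powr p)"
  using assms by (simp add: lp_norm_def powr_powr sum_nonneg)

lemma lp_norm_eq_0_iff: "lp_norm p x = 0 \<longleftrightarrow> x = 0"
  by (simp add: lp_norm_def sum_nonneg_eq_0_iff vec_eq_iff)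

lemma lp_norm_pos: "x \<noteq> 0 \<Longrightarrow> 0 < lp_norm p x"
  using lp_norm_nonneg[of p x] lp_norm_eq_0_iff[of p x] by linarith

lemma lp_norm_minus: "lp_norm p (- x) = lp_norm p x"
  by (simp add: lp_norm_def)

lemma lp_norm_scaleR:
  assumes "p \<noteq> 0" "0 \<le> c"
  shows "lp_norm p (c *\<^sub>R x) = c * lp_norm p x"
proof -
  have "lp_norm p (c *\<^sub>R x) = (c powr p * (\<Sum>i\<in>UNIV. \<bar>x $ i\<bar> powr p)) powr (1 / p)"
    using assms by (simp add: lp_norm_def abs_mult powr_mult sum_distrib_left)
  also have "\<dots> = c * lp_norm p x"
    using assms by (simp add: lp_norm_def powr_mult powr_powr sum_nonneg)
  finally show ?thesis .
qed

lemma lp_norm_2: "lp_norm 2 x = norm x"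
  by (simp add: lp_norm_def norm_vec_def L2_set_def powr_half_sqrt sum_nonneg)

text \<open>Equality case of Hoelder: on the p-ball through \<open>w\<close>, the functional
  \<open>dual_vec p w\<close> is maximal only at \<open>w\<close>. The summed tangent inequalities
  become strict as soon as one coordinate of \<open>y\<close> differs from that of
  \<open>w\<close>.\<close>

lemma eq_if_lp_norm_le_inner_ge:
  fixes w y :: "real ^ 'm"
  assumes p: "1 < p" and le: "lp_norm p y \<le> lp_norm p w"
    and ge: "lp_norm p w powr p \<le> dual_vec p w \<bullet> y"
  shows "y = w"
proof (rule ccontr)
  assume "y \<noteq> w"
  then obtain j where j: "y $ j \<noteq> w $ j" by (auto simp: vec_eq_iff)
  let ?L = "\<lambda>i. \<bar>w $ i\<bar> powr p + p * (dual_vec p w $ i * (y $ i - w $ i))"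
  have "?L i \<le> \<bar>y $ i\<bar> powr p" for i
    using abs_powr_gt_tangent[OF p, of "y $ i" w i] by (cases "y $ i = w $ i") auto
  then have "(\<Sum>i\<in>UNIV. ?L i) < (\<Sum>i\<in>UNIV. \<bar>y $ i\<bar> powr p)"
    using abs_powr_gt_tangent[OF p j] by (intro sum_strict_mono_ex1) auto
  also have "\<dots> \<le> lp_norm p w powr p"
    using p le powr_mono2[OF _ lp_norm_nonneg le, of p] by (simp add: lp_norm_powr)
  finally have "(\<Sum>i\<in>UNIV. ?L i) < lp_norm p w powr p" .
  \<comment> \<open>The inner product of \<open>dual_vec p w\<close> with \<open>w\<close> itself is
    \<open>lp_norm p w powr p\<close>.\<close>
  moreover have "(\<Sum>i\<in>UNIV. ?L i)
      = lp_norm p w powr p + p * (dual_vec p w \<bullet> y - lp_norm p w powr p)"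
    using p by (simp add: lp_norm_powr inner_vec_def sum.distrib sum_subtractf
        flip: sum_distrib_left dual_vec_mult_self) (simp add: algebra_simps sum_subtractf)
  ultimately show False using p ge by (simp add: mult_less_0_iff)
qed

text \<open>All conditions are homogeneous in \<open>(x, t)\<close>, so for \<open>t > 0\<close> the
  point can be rescaled to height \<open>lp_norm p w\<close>, where the uniqueness of the maximizer
  applies. At \<open>t = 0\<close> the cone contains only its apex.\<close>

lemma in_ray_if_functional_nonpos:
  fixes w x :: "real ^ 'm"
  assumes p: "1 < p" and w: "w \<noteq> 0" and K: "(x, t) \<in> p_cone p"
    and le: "lp_norm p w powr (p - 1) * t \<le> dual_vec p w \<bullet> x"
  shows "(x, t) \<in> ray (w, lp_norm p w)"
proof -
  define T where "T = lp_norm p w"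
  have T: "0 < T" using w by (simp add: T_def lp_norm_pos)
  have xt: "lp_norm p x \<le> t" using K by (simp add: p_cone_def)
  then have t: "0 \<le> t" using lp_norm_nonneg[of p x] by linarith
  show ?thesis
  proof (cases "t = 0")
    case True
    then have "x = 0" using xt lp_norm_nonneg[of p x] lp_norm_eq_0_iff[of p x] by linarith
    then have "(x, t) = 0 *\<^sub>R (w, lp_norm p w)" using True by (simp add: zero_prod_def)
    then show ?thesis unfolding ray_def by blast
  next
    case False
    then have t: "0 < t" using t by simp
    have "(T / t) *\<^sub>R x = w"
    proof (rule eq_if_lp_norm_le_inner_ge[OF p])
      have "T / t * lp_norm p x \<le> T / t * t" using T t xt by (intro mult_left_mono) auto
      then show "lp_norm p ((T / t) *\<^sub>R x) \<le> lp_norm p w"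
        using p T t by (simp add: lp_norm_scaleR flip: T_def)
      have "T powr p = T / t * (T powr (p - 1) * t)"
        using T t powr_add[of T "p - 1" 1] by simp
      also have "\<dots> \<le> T / t * (dual_vec p w \<bullet> x)"
        using T t le by (intro mult_left_mono) (auto simp: T_def)
      finally show "lp_norm p w powr p \<le> dual_vec p w \<bullet> ((T / t) *\<^sub>R x)"
        by (simp add: T_def)
    qed
    then have "(x, t) = (t / T) *\<^sub>R (w, lp_norm p w)"
      using T t by (auto simp: T_def[symmetric])
    then show ?thesis unfolding ray_def using T t by (smt (verit) divide_nonneg_pos mem_Collect_eq)
  qed
qed

lemma ray_face_of_p_cone:
  fixes w :: "real ^ 'm"
  assumes p: "1 < p" and w: "w \<noteq> 0"
  shows "ray (w, lp_norm p w) face_of p_cone p"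
proof -
  define T where "T = lp_norm p w"
  \<comment> \<open>The factor \<open>T powr (p - 1)\<close> is the dual norm of
    \<open>dual_vec p w\<close>, the value for which \<phi> vanishes at
    \<open>(w, T)\<close>.\<close>
  define \<phi> where "\<phi> v = T powr (p - 1) * snd v - dual_vec p w \<bullet> fst v" for v :: "(real ^ 'm) \<times> real"
  have T: "0 < T" using w by (simp add: T_def lp_norm_pos)
  have add: "\<phi> (v + v') = \<phi> v + \<phi> v'" for v v' by (simp add: \<phi>_def algebra_simps)
  have scale: "\<phi> (c *\<^sub>R v) = c * \<phi> v" for c v by (simp add: \<phi>_def algebra_simps)
  have ray: "v \<in> ray (w, T)" if "v \<in> p_cone p" "\<phi> v \<le> 0" for v
    using in_ray_if_functional_nonpos[OF p w, of "fst v" "snd v"] that by (simp add: \<phi>_def T_def)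
  have "\<phi> (w, T) = T powr p - (\<Sum>i\<in>UNIV. dual_vec p w $ i * w $ i)"
    using T powr_add[of T "p - 1" 1] by (simp add: \<phi>_def inner_vec_def)
  then have "\<phi> (w, T) = 0"
    using p by (simp add: dual_vec_mult_self T_def lp_norm_powr)
  then have \<phi>0: "\<phi> v = 0" if "v \<in> ray (w, T)" for v
    using that scale unfolding ray_def by fastforce
  \<comment> \<open>A nonpositive value would place \<open>v\<close> on the ray, where \<phi> is
    zero; hence no negative value occurs on the cone.\<close>
  have \<phi>_nonneg: "0 \<le> \<phi> v" if "v \<in> p_cone p" for v
    using ray[OF that] \<phi>0[of v] by fastforce
  have "ray (w, T) \<subseteq> p_cone p"
    using p by (auto simp: ray_def p_cone_def lp_norm_scaleR T_def)
  moreover have "convex (ray (w, T))"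
  proof (rule convexI)
    fix x y and u v :: real
    assume "x \<in> ray (w, T)" "y \<in> ray (w, T)" and uv: "0 \<le> u" "0 \<le> v"
    then obtain a b where ab: "0 \<le> a" "x = a *\<^sub>R (w, T)" "0 \<le> b" "y = b *\<^sub>R (w, T)"
      by (auto simp: ray_def)
    then have "u *\<^sub>R x + v *\<^sub>R y = (u * a + v * b) *\<^sub>R (w, T)"
      by (simp only: scaleR_add_left scaleR_scaleR)
    moreover have "0 \<le> u * a + v * b" using ab uv by simp
    ultimately show "u *\<^sub>R x + v *\<^sub>R y \<in> ray (w, T)" unfolding ray_def by blast
  qed
  moreover have "a \<in> ray (w, T) \<and> b \<in> ray (w, T)"
    if "a \<in> p_cone p" "b \<in> p_cone p" "v \<in> ray (w, T)"
      and v: "v \<in> open_segment a b" for a b v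
  proof -
    obtain u where u: "0 < u" "u < 1" "v = (1 - u) *\<^sub>R a + u *\<^sub>R b"
      using v by (auto simp: in_segment)
    \<comment> \<open>Two nonnegative terms with sum 0 both vanish, which forces both endpoints onto
      the ray.\<close>
    then have "(1 - u) * \<phi> a + u * \<phi> b = 0"
      using \<phi>0[OF that(3)] by (simp add: add scale)
    moreover have "0 \<le> (1 - u) * \<phi> a" "0 \<le> u * \<phi> b"
      using u \<phi>_nonneg that by auto
    ultimately have "(1 - u) * \<phi> a = 0" "u * \<phi> b = 0" by linarith+
    then have "\<phi> a = 0" "\<phi> b = 0" using u by auto
    then show ?thesis using ray that by simp
  qed
  ultimately show ?thesis unfolding T_def[symmetric] face_of_def by blast
qed

lemma in_ray_self: "u \<in> ray u"
  unfolding ray_def by (auto intro!: exI[of _ 1])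

lemma ray_scaleR:
  assumes "0 < c"
  shows "ray (c *\<^sub>R u) = ray u"
proof
  show "ray (c *\<^sub>R u) \<subseteq> ray u"
    using assms by (force simp: ray_def)
  show "ray u \<subseteq> ray (c *\<^sub>R u)"
  proof
    fix v assume "v \<in> ray u"
    then obtain a where "0 \<le> a" "v = a *\<^sub>R u" by (auto simp: ray_def)
    then show "v \<in> ray (c *\<^sub>R u)"
      using assms unfolding ray_def by (auto intro!: exI[of _ "a / c"])
  qed
qed

lemma normalized_in_extremal_section:
  fixes w :: "real ^ 'm"
  assumes "1 < p" "w \<noteq> 0"
  shows "(1 / norm (w, lp_norm p w)) *\<^sub>R (w, lp_norm p w) \<in> extremal_section (p_cone p)"
proof -
  define v where "v = (w, lp_norm p w)"
  have v: "v \<noteq> 0" using assms by (simp add: v_def zero_prod_def)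
  moreover have "ray v face_of p_cone p"
    using ray_face_of_p_cone[OF assms] by (simp add: v_def)
  ultimately have "(1 / norm v) *\<^sub>R v \<in> extremal_section (p_cone p)"
    unfolding extremal_section_def extreme_ray_of_def using ray_scaleR[of "1 / norm v" v]
    by (auto intro!: exI[of _ v] simp del: split_paired_Ex)
  then show ?thesis unfolding v_def .
qed

lemma axis_point_in_affine_hull:
  fixes w :: "real ^ 'm"
  assumes "1 < p" "w \<noteq> 0"
  shows "(0 :: real ^ 'm, lp_norm p w / norm (w, lp_norm p w)) \<in> affine hull extremal_section (p_cone p)"
proof -
  define T where "T = lp_norm p w"
  define N where "N = norm (w, T)"
  have N: "norm (- w, T) = N" by (simp add: N_def norm_Pair)
  have "(1 / N) *\<^sub>R (w, T) \<in> extremal_section (p_cone p)"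
    using normalized_in_extremal_section[OF assms] by (simp add: N_def T_def)
  moreover have "(1 / N) *\<^sub>R (- w, T) \<in> extremal_section (p_cone p)"
    using normalized_in_extremal_section[of p "- w"] assms N by (simp add: T_def lp_norm_minus)
  ultimately have "(1/2) *\<^sub>R (1 / N) *\<^sub>R (w, T) + (1/2) *\<^sub>R (1 / N) *\<^sub>R (- w, T)
      \<in> affine hull extremal_section (p_cone p)"
    by (intro mem_affine[OF affine_affine_hull] hull_inc) auto
  then show ?thesis by (simp add: N_def T_def)
qed

lemma zero_in_affine_if_two_axis_points:
  fixes a b :: real
  assumes "affine S" "(0, a) \<in> S" "(0, b) \<in> S" "a \<noteq> b"
  shows "0 \<in> S"
proof -
  \<comment> \<open>The weights sum to 1 and are chosen so that the second coordinates
    cancel.\<close>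
  have "(b / (b - a)) *\<^sub>R (0, a) + (- a / (b - a)) *\<^sub>R (0, b) \<in> S"
    using assms by (intro mem_affine) (auto simp: diff_divide_distrib[symmetric])
  then show ?thesis by (simp add: zero_prod_def)
qed

lemma norm_eq_if_in_extremal_section:
  fixes x :: "real ^ 'm"
  assumes "(x, t) \<in> extremal_section (p_cone 2)"
  shows "norm x = t"
proof (rule ccontr)
  assume ne: "norm x \<noteq> t"
  have face: "ray (x, t) face_of p_cone 2"
    using assms by (simp add: extremal_section_def extreme_ray_of_def)
  then have "norm x \<le> t"
    using in_ray_self[of "(x, t)"] by (auto simp: face_of_def p_cone_def lp_norm_2)
  then have t: "norm x < t" "0 < t" using ne norm_ge_zero[of x] by linarith+
  \<comment> \<open>The length of \<open>v\<close> is exactly the slack, so the triangle inequality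
    keeps both \<open>x + v\<close> and \<open>x - v\<close> in the cone at height
    \<open>t\<close>.\<close>
  obtain v :: "real ^ 'm" where v: "norm v = t - norm x"
    using vector_choose_size[of "t - norm x"] t by auto
  then have "v \<noteq> 0" using t by auto
  have "(x + v, t) \<in> p_cone 2" "(x - v, t) \<in> p_cone 2"
    using norm_triangle_ineq[of x v] norm_triangle_ineq4[of x v] v
    by (auto simp: p_cone_def lp_norm_2)
  moreover have "(x, t) \<in> open_segment (x + v, t) (x - v, t)"
    using \<open>v \<noteq> 0\<close> midpoint_in_open_segment[of "(x + v, t)" "(x - v, t)"]
    by (auto simp: midpoint_def vec_eq_iff simp flip: scaleR_2)
  ultimately have "(x + v, t) \<in> ray (x, t)"
    using face in_ray_self[of "(x, t)"] unfolding face_of_def by blast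
  \<comment> \<open>As \<open>t > 0\<close>, the only point of the ray at height \<open>t\<close> is
    \<open>(x, t)\<close>, contradicting \<open>v \<noteq> 0\<close>.\<close>
  then show False using t \<open>v \<noteq> 0\<close> by (auto simp: ray_def)
qed

theorem proposition6p12:
  fixes p :: real and n :: nat
  assumes "1 < p" and "3 \<le> n" and "CARD('m::finite) = n - 1"
  shows "0 \<in> affine hull (extremal_section (p_cone p :: ((real ^ 'm) \<times> real) set)) \<longleftrightarrow> p \<noteq> 2"
proof
  let ?E = "extremal_section (p_cone p :: ((real ^ 'm) \<times> real) set)"
  show "p \<noteq> 2" if "0 \<in> affine hull ?E"
  proof
    assume p: "p = 2"
    have "(0, 1) \<bullet> u = 1 / sqrt 2" if "u \<in> ?E" for u
    proof (cases u)
      case (Pair x t)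
      have "norm x = t" using that p Pair norm_eq_if_in_extremal_section by blast
      moreover have "norm u = 1" using that by (simp add: extremal_section_def)
      ultimately have "0 \<le> t" "sqrt (2 * t\<^sup>2) = 1" by (auto simp: Pair norm_Pair)
      then show ?thesis by (simp add: Pair real_sqrt_mult field_simps)
    qed
    then have "affine hull ?E \<subseteq> {u. (0, 1) \<bullet> u = 1 / sqrt 2}"
      by (intro hull_minimal affine_hyperplane) auto
    then show False using that by auto
  qed
  assume "p \<noteq> 2"
  \<comment> \<open>Here \<open>3 \<le> n\<close> enters: it provides two distinct
    coordinates.\<close>
  have "\<not> CARD('m) \<le> Suc 0" using assms by linarith
  then obtain i j :: 'm where ij: "i \<noteq> j"
    by (metis card_le_Suc0_iff_eq finite_class.finite_UNIV)
  let ?v = "axis i 1 :: real ^ 'm" and ?w = "axis i 1 + axis j 1 :: real ^ 'm"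
  have "(\<Sum>k\<in>UNIV. \<bar>?v $ k\<bar> powr p) = (\<Sum>k\<in>{i}. 1)"
    using assms(1) by (intro sum.mono_neutral_cong_right) (auto simp: axis_def)
  then have lpv: "lp_norm p ?v = 1" by (simp add: lp_norm_def)
  have "(\<Sum>k\<in>UNIV. \<bar>?w $ k\<bar> powr p) = (\<Sum>k\<in>{i, j}. 1)"
    using assms(1) ij by (intro sum.mono_neutral_cong_right) (auto simp: axis_def)
  then have lpw: "lp_norm p ?w = 2 powr (1 / p)" using ij by (simp add: lp_norm_def)
  have nw: "(norm ?w)\<^sup>2 = 2"
    using ij by (simp add: power2_norm_eq_inner inner_add inner_axis_axis)
  \<comment> \<open>The p-norm of \<open>?w\<close>. As \<open>?w\<close> has squared Euclidean norm
    2, its axis point has height \<open>a / sqrt (2 + a\<^sup>2)\<close>; that of \<open>?v\<close>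
    has height \<open>1 / sqrt 2\<close>.\<close>
  define a where "a = (2::real) powr (1 / p)"
  have "a\<^sup>2 \<noteq> 2"
  proof
    assume "a\<^sup>2 = 2"
    then have "(2::real) powr (2 / p) = 2 powr 1" by (simp add: a_def power2_eq_square flip: powr_add)
    then show False using \<open>p \<noteq> 2\<close> assms(1) using powr_inj[of 2 "2 / p" 1] by simp
  qed
  have "1 / sqrt 2 \<noteq> a / sqrt (2 + a\<^sup>2)"
  proof
    assume "1 / sqrt 2 = a / sqrt (2 + a\<^sup>2)"
    \<comment> \<open>Cross-multiplying the squares gives
      \<open>2 + a\<^sup>2 = 2 * a\<^sup>2\<close>, that is \<open>a\<^sup>2 = 2\<close>.\<close>
    then have "(1 / sqrt 2)\<^sup>2 = (a / sqrt (2 + a\<^sup>2))\<^sup>2" by simp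
    moreover have "2 + a\<^sup>2 > 0" by (simp add: add_pos_nonneg)
    ultimately show False using \<open>a\<^sup>2 \<noteq> 2\<close> by (simp add: power_divide field_simps)
  qed
  moreover have "(0, 1 / sqrt 2) \<in> affine hull ?E"
    using axis_point_in_affine_hull[OF assms(1), of ?v] by (simp add: lpv norm_Pair axis_eq_0_iff)
  moreover have "(0, a / sqrt (2 + a\<^sup>2)) \<in> affine hull ?E"
  proof -
    have "?w \<noteq> 0" using nw by auto
    from axis_point_in_affine_hull[OF assms(1) this] show ?thesis
      by (simp add: lpw norm_Pair nw a_def)
  qed
  ultimately show "0 \<in> affine hull ?E"
    using zero_in_affine_if_two_axis_points[OF affine_affine_hull] by blast
qed

end
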